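(* Let $F \subseteq \mathbb{R}^d$ be the attractor of an iterated function system consisting of bi-Lipschitz contractions, and assume $F$ is not a singleton. Then there exists $\theta_0 \in (0,1)$ such that $\dim_{\mathrm{L}}^{\theta} F > 0$ for all $\theta \in (0,\theta_0)$, and $\dim_{\mathrm{L}}^{\theta} F \to \underline{\dim}_{\mathrm{B}} F$ as $\theta \to 0$.
   Context: An iterated function system (IFS) is a finite collection $\{S_i\}_{i\in\mathcal{I}}$ of contractions of a compact set $X \subseteq \mathbb{R}^d$ into itself (a contraction satisfies $|S(x)-S(y)| \le c|x-y|$ for all $x,y\in X$, for some $c\in(0,1)$). Its attractor is the unique non-empty compact set $F\subseteq X$ with $F=\bigcup_{i\in\mathcal{I}} S_i(F)$. "Bi-Lipschitz contraction" means there are constants $0<b_i\le c_i<1$ with $b_i|x-y| \le |S_i(x)-S_i(y)| \le c_i|x-y|$ for all $x,y\in X$. For a bounded set $E$ and $r>0$, $N_r(E)$ is the minimal number of open sets of diameter at most $r$ needed to cover $E$. The lower box dimension is $\underline{\dim}_{\mathrm{B}} F=\liminf_{r\to 0}\frac{\log N_r(F)}{-\log r}$. For $\theta\in(0,1)$, the lower spectrum $\dim_{\mathrm{L}}^{\theta}F$ is the supremum of all $\alpha\ge 0$ for which there is a constant $C>0$ such that for all $0<r<1$ and $x\in F$, $N_r(B(x,r^\theta)\cap F)\ge C\,(r^{\theta}/r)^{\alpha}$. Here $B(x,\rho)$ is the closed ball of centre $x$ and radius $\rho$. *)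

theory Defs
  imports "HOL-Analysis.Analysis"
begin

definition contraction_on :: "'a::metric_space set \<Rightarrow> ('a \<Rightarrow> 'a) \<Rightarrow> bool" where
  "contraction_on X f \<longleftrightarrow>
     (\<exists>c. 0 < c \<and> c < 1 \<and> (\<forall>x\<in>X. \<forall>y\<in>X. dist (f x) (f y) \<le> c * dist x y))"

definition bilipschitz_contraction_on :: "'a::metric_space set \<Rightarrow> ('a \<Rightarrow> 'a) \<Rightarrow> bool" where
  "bilipschitz_contraction_on X f \<longleftrightarrow>
     (\<exists>b c. 0 < b \<and> b \<le> c \<and> c < 1 \<and>
        (\<forall>x\<in>X. \<forall>y\<in>X. b * dist x y \<le> dist (f x) (f y) \<and> dist (f x) (f y) \<le> c * dist x y))"

definition iterated_function_system ::
    "'a::metric_space set \<Rightarrow> 'i set \<Rightarrow> ('i \<Rightarrow> 'a \<Rightarrow> 'a) \<Rightarrow> bool" where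
  "iterated_function_system X I S \<longleftrightarrow>
     compact X \<and> finite I \<and> (\<forall>i\<in>I. S i ` X \<subseteq> X \<and> contraction_on X (S i))"

text \<open>By Hutchinson's theorem at most one set \<open>F\<close> satisfies this predicate for a given iterated
  function system, so uniqueness is not part of the definition.\<close>

definition is_attractor ::
    "'a::metric_space set \<Rightarrow> 'i set \<Rightarrow> ('i \<Rightarrow> 'a \<Rightarrow> 'a) \<Rightarrow> 'a set \<Rightarrow> bool" where
  "is_attractor X I S F \<longleftrightarrow>
     F \<noteq> {} \<and> compact F \<and> F \<subseteq> X \<and> F = (\<Union>i\<in>I. S i ` F)"

text \<open>Boundedness of the covering sets is required explicitly because \<^const>\<open>diameter\<close> is an
  unspecified real number on unbounded sets. In a Euclidean space the \<open>LEAST\<close> exists whenever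
  \<open>E\<close> is bounded and \<open>r > 0\<close>.\<close>

definition covering_number :: "real \<Rightarrow> 'a::metric_space set \<Rightarrow> nat" where
  "covering_number r E =
     (LEAST n. \<exists>\<U>. finite \<U> \<and> card \<U> = n \<and> E \<subseteq> \<Union>\<U> \<and>
        (\<forall>U\<in>\<U>. open U \<and> bounded U \<and> diameter U \<le> r))"

definition lower_box_dim :: "'a::metric_space set \<Rightarrow> ereal" where
  "lower_box_dim F =
     Liminf (at_right 0) (\<lambda>r::real. ereal (ln (real (covering_number r F)) / - ln r))"

definition lower_spectrum :: "real \<Rightarrow> 'a::metric_space set \<Rightarrow> ereal" where
  "lower_spectrum \<theta> F =
     Sup {ereal \<alpha> |\<alpha>. 0 \<le> \<alpha> \<and>
       (\<exists>C>0. \<forall>r. 0 < r \<and> r < 1 \<longrightarrow>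
          (\<forall>x\<in>F. real (covering_number r (cball x (r powr \<theta>) \<inter> F))
                    \<ge> C * (r powr \<theta> / r) powr \<alpha>))}"

end

theory Submission imports Defs begin

text \<open>Let all maps multiply distances by factors between \<open>b\<close> and \<open>c\<close>, and put
  \<open>s = ln b / ln c\<close>. Around every \<open>x \<in> F\<close>, the ball of radius \<open>\<rho>\<close> contains a cylinder, that is, a copy
  of \<open>F\<close> in which distances shrink at most by a factor comparable to \<open>\<rho> powr s\<close>. Hence covering
  \<open>F \<inter> B(x, r powr \<theta>)\<close> at scale \<open>r\<close> is at least as expensive as covering \<open>F\<close> at a scale comparable
  to \<open>r powr (1 - \<theta> s)\<close>. With \<open>B\<close> the lower box dimension and \<open>L\<close> the lower spectrum at \<open>\<theta>\<close>, this gives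
  \<open>(1 - \<theta> s) / (1 - \<theta>) * B \<le> L\<close>, while \<open>L \<le> B / (1 - \<theta>)\<close> is immediate; let \<open>\<theta>\<close> tend to 0. Positivity
  of \<open>L\<close> for \<open>\<theta> s < 1\<close> reduces to \<open>B > 0\<close>, which holds because \<open>F\<close> contains two disjoint cylinders of
  the same level.\<close>

section \<open>Covering numbers in compact sets\<close>

lemma covering_number_le_card:
  assumes "finite \<U>" "E \<subseteq> \<Union>\<U>" "\<And>U. U \<in> \<U> \<Longrightarrow> open U \<and> bounded U \<and> diameter U \<le> r"
  shows "covering_number r E \<le> card \<U>"
  unfolding covering_number_def by (rule Least_le) (use assms in blast)

lemma diameter_le_metric:
  fixes A :: "'a::metric_space set"
  assumes "0 \<le> d" "\<And>x y. x \<in> A \<Longrightarrow> y \<in> A \<Longrightarrow> dist x y \<le> d"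
  shows "diameter A \<le> d"
  \<comment> \<open>The bound \<open>0 \<le> d\<close> takes care of the empty set, whose
    \<open>diameter\<close> is 0 by definition.\<close>
  unfolding diameter_def using assms by (auto intro!: cSUP_least)

lemma diameter_ball_le:
  fixes x :: "'a::metric_space"
  assumes "0 \<le> e"
  shows "diameter (ball x e) \<le> 2 * e"
proof (rule diameter_le_metric)
  show "0 \<le> 2 * e" using assms by simp
  fix u v assume "u \<in> ball x e" "v \<in> ball x e"
  then show "dist u v \<le> 2 * e"
    using dist_triangle3[of u v x] by simp
qed

text \<open>Guarantees that the \<open>LEAST\<close> in \<open>covering_number\<close> is attained:
  \<open>K\<close> is totally bounded, and balls of radius \<open>r / 2\<close> are admissible
  covering sets. Only containment in a compact \<open>K\<close> is asked of \<open>E\<close>, so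
  images of \<open>F\<close> and its intersections with balls qualify.\<close>

lemma covering_number_witness:
  fixes E :: "'a::metric_space set"
  assumes "compact K" "E \<subseteq> K" "0 < r"
  obtains \<U> where "finite \<U>" "card \<U> = covering_number r E" "E \<subseteq> \<Union>\<U>"
    "\<And>U. U \<in> \<U> \<Longrightarrow> open U \<and> bounded U \<and> diameter U \<le> r"
proof -
  obtain A where A: "finite A" "K \<subseteq> (\<Union>x\<in>A. ball x (r / 2))"
    using compact_imp_seq_compact[OF assms(1)] seq_compact_imp_totally_bounded assms(3)
    by (metis half_gt_zero)
  let ?P = "\<lambda>n. \<exists>\<U>. finite \<U> \<and> card \<U> = n \<and> E \<subseteq> \<Union>\<U> \<and>
        (\<forall>U\<in>\<U>. open U \<and> bounded U \<and> diameter U \<le> r)"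
  have "?P (card ((\<lambda>x. ball x (r / 2)) ` A))"
    using A assms diameter_ball_le[of "r / 2"]
    by (intro exI[of _ "(\<lambda>x. ball x (r / 2)) ` A"]) auto
  then have "?P (covering_number r E)"
    unfolding covering_number_def by (rule LeastI)
  then show thesis using that by blast
qed

lemma covering_number_mono:
  fixes E :: "'a::metric_space set"
  assumes "compact K" "E \<subseteq> E'" "E' \<subseteq> K" "0 < r"
  shows "covering_number r E \<le> covering_number r E'"
proof -
  obtain \<U> where \<U>: "finite \<U>" "card \<U> = covering_number r E'" "E' \<subseteq> \<Union>\<U>"
    "\<And>U. U \<in> \<U> \<Longrightarrow> open U \<and> bounded U \<and> diameter U \<le> r"
    using covering_number_witness[OF assms(1,3,4)] by metis
  show ?thesis
    using covering_number_le_card[of \<U> E r] \<U> assms(2) by auto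
qed

text \<open>A covering set of diameter at most \<open>r\<close> contains at most one point of
  \<open>A\<close>, so choosing a covering set for each point is injective.\<close>

lemma card_separated_le_covering_number:
  fixes E :: "'a::metric_space set"
  assumes "compact K" "E \<subseteq> K" "0 < r" "A \<subseteq> E"
    and sep: "\<And>x y. x \<in> A \<Longrightarrow> y \<in> A \<Longrightarrow> x \<noteq> y \<Longrightarrow> r < dist x y"
  shows "card A \<le> covering_number r E"
proof -
  obtain \<U> where \<U>: "finite \<U>" "card \<U> = covering_number r E" "E \<subseteq> \<Union>\<U>"
    "\<And>U. U \<in> \<U> \<Longrightarrow> open U \<and> bounded U \<and> diameter U \<le> r"
    using covering_number_witness[OF assms(1,2,3)] by metis
  have "\<forall>x\<in>A. \<exists>U\<in>\<U>. x \<in> U" using \<U>(3) assms(4) by blast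
  then obtain g where g: "\<And>x. x \<in> A \<Longrightarrow> g x \<in> \<U> \<and> x \<in> g x" by metis
  have "inj_on g A"
  proof (rule inj_onI, rule ccontr)
    fix x y assume xy: "x \<in> A" "y \<in> A" "g x = g y" "x \<noteq> y"
    then have "dist x y \<le> diameter (g x)"
      using g \<U>(4) by (intro diameter_bounded_bound) metis+
    also have "\<dots> \<le> r" using g \<U>(4) xy(1) by blast
    finally show False using sep xy by force
  qed
  then have "card A \<le> card \<U>" using g \<U>(1) by (intro card_inj_on_le) auto
  then show ?thesis using \<U>(2) by simp
qed

lemma covering_number_pos:
  fixes E :: "'a::metric_space set"
  assumes "compact K" "E \<subseteq> K" "0 < r" "E \<noteq> {}"
  shows "1 \<le> covering_number r E"
proof -
  obtain x where "x \<in> E" using assms(4) by blast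
  then show ?thesis
    using card_separated_le_covering_number[OF assms(1-3), of "{x}"] by auto
qed

text \<open>A pulled-back covering set need not be open in the ambient space; thickening it to make it
  open costs the factor 2.\<close>

lemma covering_number_image_ge:
  fixes E :: "'a::metric_space set"
  assumes "compact K" "T ` E \<subseteq> K" "0 < r" "0 < L"
    and low: "\<And>x y. x \<in> E \<Longrightarrow> y \<in> E \<Longrightarrow> L * dist x y \<le> dist (T x) (T y)"
  shows "covering_number (2 * r / L) E \<le> covering_number r (T ` E)"
proof -
  obtain \<U> where \<U>: "finite \<U>" "card \<U> = covering_number r (T ` E)" "T ` E \<subseteq> \<Union>\<U>"
    "\<And>U. U \<in> \<U> \<Longrightarrow> open U \<and> bounded U \<and> diameter U \<le> r"
    using covering_number_witness[OF assms(1-3)] by metis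
  \<comment> \<open>A pulled-back set has diameter at most \<open>r / L\<close>. Thickening by
    \<open>e\<close> adds \<open>2 * e = r / L\<close>, for a total of
    \<open>2 * r / L\<close>.\<close>
  define e where "e = r / (2 * L)"
  have e: "0 < e" using assms by (simp add: e_def)
  define V where "V U = (\<Union>x\<in>{x\<in>E. T x \<in> U}. ball x e)" for U
  have dV: "dist u v \<le> 2 * r / L" if U: "U \<in> \<U>" and uv: "u \<in> V U" "v \<in> V U" for U u v
  proof -
    obtain x y where xy: "x \<in> E" "T x \<in> U" "dist x u < e" "y \<in> E" "T y \<in> U" "dist y v < e"
      using uv by (auto simp: V_def)
    have "L * dist x y \<le> dist (T x) (T y)" using low xy by blast
    also have "\<dots> \<le> diameter U" using xy \<U>(4) U by (intro diameter_bounded_bound) auto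
    also have "\<dots> \<le> r" using \<U>(4) U by blast
    finally have "dist x y \<le> r / L" using assms(4) by (simp add: field_simps)
    moreover have "dist u v \<le> dist x u + dist x y + dist y v"
      using dist_triangle[of u v x] dist_triangle[of x v y] by (simp add: dist_commute)
    moreover have "2 * r / L = r / L + 2 * e" using assms(4) by (simp add: e_def field_simps)
    ultimately show ?thesis using xy by linarith
  qed
  have "covering_number (2 * r / L) E \<le> card (V ` \<U>)"
  proof (rule covering_number_le_card)
    show "finite (V ` \<U>)" using \<U>(1) by simp
    show "E \<subseteq> \<Union> (V ` \<U>)"
    proof
      fix x assume x: "x \<in> E"
      then obtain U where "U \<in> \<U>" "T x \<in> U" using \<U>(3) by blast
      then show "x \<in> \<Union> (V ` \<U>)" using x e by (auto simp: V_def intro!: bexI[of _ U])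
    qed
    fix W assume "W \<in> V ` \<U>"
    then obtain U where U: "U \<in> \<U>" "W = V U" by blast
    have "open W" by (auto simp: U V_def)
    moreover have "bounded W" using dV[OF U(1)] U(2) bounded_two_points by blast
    moreover have "diameter W \<le> 2 * r / L"
      by (rule diameter_le_metric) (use dV[OF U(1)] U(2) assms in auto)
    ultimately show "open W \<and> bounded W \<and> diameter W \<le> 2 * r / L" by blast
  qed
  also have "\<dots> \<le> card \<U>" using \<U>(1) by (rule card_image_le)
  finally show ?thesis using \<U>(2) by simp
qed

section \<open>Lower box dimension and power bounds on covering numbers\<close>

text \<open>After taking logarithms and dividing by \<open>- ln r\<close>, the constant contributes
  \<open>ln C / - ln r\<close>, which tends to 0; only the exponent survives.\<close>

lemma lower_box_dim_geI:
  fixes F :: "'a::metric_space set"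
  assumes "0 < C" "0 < r0"
    and low: "\<And>r. 0 < r \<Longrightarrow> r < r0 \<Longrightarrow> C * r powr (-t) \<le> real (covering_number r F)"
  shows "ereal t \<le> lower_box_dim F"
proof -
  have "filterlim (\<lambda>r::real. - ln r) at_top (at_right 0)"
    using ln_at_0 by (simp add: filterlim_uminus_at_bot)
  then have "((\<lambda>r. ln C / - ln r) \<longlongrightarrow> 0) (at_right 0)"
    by (intro tendsto_divide_0[OF tendsto_const] filterlim_at_top_imp_at_infinity)
  then have "((\<lambda>r. ereal (ln C / - ln r + t)) \<longlongrightarrow> ereal (0 + t)) (at_right 0)"
    by (intro tendsto_ereal tendsto_add tendsto_const)
  then have "Liminf (at_right 0) (\<lambda>r. ereal (ln C / - ln r + t)) = ereal t"
    by (intro lim_imp_Liminf) simp_all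
  moreover have "eventually (\<lambda>r. ereal (ln C / - ln r + t) \<le>
      ereal (ln (real (covering_number r F)) / - ln r)) (at_right 0)"
    unfolding eventually_at_right_field
  \<comment> \<open>Below 1 the denominator \<open>- ln r\<close> is positive, so dividing by it
    preserves the inequality.\<close>
  proof (intro exI[of _ "min r0 1"] conjI allI impI)
    show "0 < min r0 1" using assms by simp
    fix r :: real assume r: "0 < r" "r < min r0 1"
    have "ln C + t * - ln r = ln (C * r powr (-t))"
      using assms r by (simp add: ln_mult ln_powr)
    also have "\<dots> \<le> ln (real (covering_number r F))"
      using low[of r] r assms by (intro ln_mono) auto
    finally have "(ln C + t * - ln r) / - ln r \<le> ln (real (covering_number r F)) / - ln r"
      using r by (intro divide_right_mono) auto
    moreover have "(ln C + t * - ln r) / - ln r = ln C / - ln r + t"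
      using r by (simp add: field_simps)
    ultimately show "ereal (ln C / - ln r + t) \<le> ereal (ln (real (covering_number r F)) / - ln r)"
      by simp
  qed
  then have "Liminf (at_right 0) (\<lambda>r. ereal (ln C / - ln r + t)) \<le> lower_box_dim F"
    unfolding lower_box_dim_def by (rule Liminf_mono)
  ultimately show ?thesis by simp
qed

lemma covering_number_ge_of_less_lower_box_dim:
  fixes F :: "'a::metric_space set"
  assumes "compact F" "F \<noteq> {}" "ereal \<alpha> < lower_box_dim F"
  obtains r0 where "0 < r0" "\<And>r. 0 < r \<Longrightarrow> r < r0 \<Longrightarrow> r powr (-\<alpha>) \<le> real (covering_number r F)"
proof -
  have "eventually (\<lambda>r. ereal \<alpha> < ereal (ln (real (covering_number r F)) / - ln r)) (at_right 0)"
    using assms(3) unfolding lower_box_dim_def by (rule less_LiminfD)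
  then obtain d where d: "0 < d"
    "\<And>r. 0 < r \<Longrightarrow> r < d \<Longrightarrow> \<alpha> < ln (real (covering_number r F)) / - ln r"
    unfolding eventually_at_right_field by auto
  show thesis
  proof (rule that[of "min d 1"])
    show "0 < min d 1" using d by simp
    fix r :: real assume r: "0 < r" "r < min d 1"
    have "\<alpha> * - ln r \<le> ln (real (covering_number r F))"
      using d(2)[of r] r by (simp add: pos_less_divide_eq field_simps)
    \<comment> \<open>Returning from \<open>ln\<close> to the covering number requires the latter to
      be positive.\<close>
    moreover have "1 \<le> covering_number r F"
      using covering_number_pos[OF assms(1) order_refl r(1) assms(2)] .
    ultimately show "r powr (-\<alpha>) \<le> real (covering_number r F)"
      using r by (simp add: powr_def ln_ge_iff)
  qed
qed

section \<open>Cylinders of a self-covering, and positivity of its lower box dimension\<close>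

text \<open>Converts a continuous scale into a cylinder level. For the first \<open>n\<close> with
  \<open>c ^ n \<le> t\<close>, either \<open>n = 0\<close>, where \<open>t \<le> 1\<close> helps,
  or the preceding power still exceeds \<open>t\<close>, so at most one factor \<open>c\<close> is
  lost.\<close>

lemma geometric_bracket:
  fixes c t :: real
  assumes "0 < c" "c < 1" "0 < t" "t \<le> 1"
  obtains n :: nat where "c ^ n \<le> t" "c * t \<le> c ^ n"
proof -
  define n where "n = (LEAST n. c ^ n \<le> t)"
  obtain m where "c ^ m < t" using real_arch_pow_inv[OF assms(3,2)] by blast
  then have n: "c ^ n \<le> t" unfolding n_def using LeastI[of "\<lambda>n. c ^ n \<le> t" m] by simp
  have "c * t \<le> c ^ n"
  proof (cases n)
    case 0
    then show ?thesis using assms by (simp add: mult_le_one)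
  next
    case (Suc k)
    then have "\<not> c ^ k \<le> t" using not_less_Least[of k "\<lambda>n. c ^ n \<le> t"] n_def by simp
    then show ?thesis using Suc assms by simp
  qed
  then show thesis using n that by blast
qed

locale bilipschitz_self_covering =
  fixes F :: "'a::metric_space set" and I :: "'i set" and S :: "'i \<Rightarrow> 'a \<Rightarrow> 'a" and b c :: real
  assumes compact_F: "compact F"
    and nonempty_F: "F \<noteq> {}"
    and self_covering: "F = (\<Union>i\<in>I. S i ` F)"
    and b_pos: "0 < b" and b_le_c: "b \<le> c" and c_less_1: "c < 1"
    and lower_lipschitz: "\<And>i x y. i \<in> I \<Longrightarrow> x \<in> F \<Longrightarrow> y \<in> F \<Longrightarrow> b * dist x y \<le> dist (S i x) (S i y)"
    and upper_lipschitz: "\<And>i x y. i \<in> I \<Longrightarrow> x \<in> F \<Longrightarrow> y \<in> F \<Longrightarrow> dist (S i x) (S i y) \<le> c * dist x y"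
begin

lemma c_pos: "0 < c"
  using b_pos b_le_c by linarith

text \<open>\<open>T\<close> is a composition of \<open>n\<close> of the maps following an address
  of \<open>x\<close>: write \<open>x = S i y\<close>, take the map of length \<open>n\<close> for
  \<open>y\<close> and apply \<open>S i\<close> last. The ratios multiply.\<close>

lemma cylinder_map:
  assumes "x \<in> F"
  shows "\<exists>T. T ` F \<subseteq> F \<and> x \<in> T ` F \<and>
    (\<forall>u\<in>F. \<forall>v\<in>F. b ^ n * dist u v \<le> dist (T u) (T v) \<and> dist (T u) (T v) \<le> c ^ n * dist u v)"
  using assms
proof (induction n arbitrary: x)
  case 0
  then show ?case by (intro exI[of _ id]) auto
next
  case (Suc n)
  obtain i y where iy: "i \<in> I" "y \<in> F" "x = S i y" using Suc.prems self_covering by blast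
  obtain T where T: "T ` F \<subseteq> F" "y \<in> T ` F"
    "\<And>u v. u \<in> F \<Longrightarrow> v \<in> F \<Longrightarrow> b ^ n * dist u v \<le> dist (T u) (T v)"
    "\<And>u v. u \<in> F \<Longrightarrow> v \<in> F \<Longrightarrow> dist (T u) (T v) \<le> c ^ n * dist u v"
    using Suc.IH[OF iy(2)] by blast
  show ?case
  proof (intro exI[of _ "S i \<circ> T"] conjI ballI)
    show "(S i \<circ> T) ` F \<subseteq> F" using T(1) iy(1) self_covering by fastforce
    show "x \<in> (S i \<circ> T) ` F" using T(2) iy(3) by auto
    fix u v assume uv: "u \<in> F" "v \<in> F"
    then have Tuv: "T u \<in> F" "T v \<in> F" using T(1) by auto
    have "b ^ Suc n * dist u v \<le> b * dist (T u) (T v)" using T(3)[OF uv] b_pos by simp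
    also have "\<dots> \<le> dist (S i (T u)) (S i (T v))" using lower_lipschitz[OF iy(1) Tuv] .
    finally show "b ^ Suc n * dist u v \<le> dist ((S i \<circ> T) u) ((S i \<circ> T) v)" by simp
    have "dist (S i (T u)) (S i (T v)) \<le> c * dist (T u) (T v)"
      using upper_lipschitz[OF iy(1) Tuv] .
    also have "\<dots> \<le> c ^ Suc n * dist u v" using T(4)[OF uv] c_pos by simp
    finally show "dist ((S i \<circ> T) u) ((S i \<circ> T) v) \<le> c ^ Suc n * dist u v" by simp
  qed
qed

lemma diameter_bound:
  obtains D where "1 \<le> D" "\<And>x y. x \<in> F \<Longrightarrow> y \<in> F \<Longrightarrow> dist x y \<le> D"
proof -
  obtain e where e: "\<forall>x\<in>F. \<forall>y\<in>F. dist x y \<le> e"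
    using compact_imp_bounded[OF compact_F] bounded_two_points by blast
  \<comment> \<open>The lower bound 1 gives \<open>\<rho> / D \<le> 1\<close> for every
    \<open>\<rho> \<le> 1\<close>, as \<open>geometric_bracket\<close> demands.\<close>
  then show thesis using that[of "max 1 e"] by force
qed

text \<open>The exponent \<open>s\<close> with \<open>b = c powr s\<close>: it converts the upper
  ratio of a cylinder of any level into its lower ratio.\<close>

definition distortion :: real where
  "distortion = ln b / ln c"

lemma distortion_pos: "0 < distortion"
  using b_pos b_le_c c_less_1 c_pos by (auto simp: distortion_def intro: divide_neg_neg)

lemma b_power_eq: "b ^ n = (c ^ n) powr distortion"
proof -
  have "ln (c ^ n) * distortion = ln (b ^ n)"
    using b_pos c_pos c_less_1 by (simp add: distortion_def ln_realpow)
  then show ?thesis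
    using b_pos c_pos by (simp add: powr_def mult.commute)
qed

text \<open>Choose the level so that \<open>c ^ n\<close> is comparable to
  \<open>\<rho> / D\<close>. The cylinder through \<open>x\<close> then fits into the ball, and
  pulling a cover of it back to \<open>F\<close> enlarges the scale by the factor
  \<open>2 / b ^ n\<close>. The constant \<open>K\<close> is uniform in \<open>x\<close>,
  \<open>r\<close> and \<open>\<rho>\<close>.\<close>

lemma covering_number_cball_ge:
  obtains K where "0 < K"
    "\<And>x r \<rho>. x \<in> F \<Longrightarrow> 0 < r \<Longrightarrow> 0 < \<rho> \<Longrightarrow> \<rho> \<le> 1 \<Longrightarrow>
      \<exists>R. 0 < R \<and> R \<le> K * r * \<rho> powr (- distortion) \<and>
        covering_number R F \<le> covering_number r (cball x \<rho> \<inter> F)"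
proof -
  obtain D where D: "1 \<le> D" "\<And>x y. x \<in> F \<Longrightarrow> y \<in> F \<Longrightarrow> dist x y \<le> D"
    using diameter_bound by blast
  let ?s = distortion
  \<comment> \<open>From \<open>c ^ n \<ge> (c / D) * \<rho>\<close>, raising to the power
    \<open>?s\<close> yields \<open>b ^ n \<ge> ?k * \<rho> powr ?s\<close>.\<close>
  let ?k = "(c / D) powr ?s"
  have k: "0 < ?k" using D c_pos by simp
  show thesis
  proof (rule that[of "2 / ?k"])
    show "0 < 2 / ?k" using k by simp
    fix x and r \<rho> :: real assume xr: "x \<in> F" "0 < r" "0 < \<rho>" "\<rho> \<le> 1"
    obtain n where n: "c ^ n \<le> \<rho> / D" "c * (\<rho> / D) \<le> c ^ n"
      by (rule geometric_bracket[OF c_pos c_less_1, of "\<rho> / D"]) (use xr D in auto)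
    obtain T where T: "T ` F \<subseteq> F" "x \<in> T ` F"
      "\<And>u v. u \<in> F \<Longrightarrow> v \<in> F \<Longrightarrow> b ^ n * dist u v \<le> dist (T u) (T v)"
      "\<And>u v. u \<in> F \<Longrightarrow> v \<in> F \<Longrightarrow> dist (T u) (T v) \<le> c ^ n * dist u v"
      using cylinder_map[OF xr(1), of n] by blast
    have sub: "T ` F \<subseteq> cball x \<rho> \<inter> F"
    proof -
      obtain y where y: "y \<in> F" "x = T y" using T(2) by blast
      have "dist x (T u) \<le> \<rho>" if "u \<in> F" for u
      proof -
        have "dist x (T u) \<le> c ^ n * dist y u" using T(4) y that by simp
        also have "\<dots> \<le> (\<rho> / D) * D"
          using n(1) D y that xr by (intro mult_mono) auto
        finally show ?thesis using D by simp
      qed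
      then show ?thesis using T(1) by auto
    qed
    have "?k * \<rho> powr ?s = (c * (\<rho> / D)) powr ?s"
      using D c_pos xr by (simp add: powr_mult powr_divide)
    also have "\<dots> \<le> (c ^ n) powr ?s"
      using n(2) D c_pos xr distortion_pos by (intro powr_mono2) auto
    finally have bn: "?k * \<rho> powr ?s \<le> b ^ n" by (simp add: b_power_eq)
    have "2 * r / b ^ n \<le> 2 * r / (?k * \<rho> powr ?s)"
      using bn k xr b_pos by (intro divide_left_mono) auto
    also have "\<dots> = 2 / ?k * r * \<rho> powr (- ?s)"
      by (simp add: powr_minus field_simps)
    finally have "2 * r / b ^ n \<le> 2 / ?k * r * \<rho> powr (- ?s)" .
    moreover have "covering_number (2 * r / b ^ n) F \<le> covering_number r (T ` F)"
      using T b_pos xr by (intro covering_number_image_ge[OF compact_F]) auto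
    moreover have "covering_number r (T ` F) \<le> covering_number r (cball x \<rho> \<inter> F)"
      using sub xr by (intro covering_number_mono[OF compact_F]) auto
    ultimately show "\<exists>R. 0 < R \<and> R \<le> 2 / ?k * r * \<rho> powr (- ?s) \<and>
        covering_number R F \<le> covering_number r (cball x \<rho> \<inter> F)"
      using xr b_pos by (intro exI[of _ "2 * r / b ^ n"]) auto
  qed
qed

text \<open>Two disjoint cylinders of the same level double the number of separated points at each
  step.\<close>

lemma separated_points:
  assumes "\<not> is_singleton F"
  obtains a \<eta> where "0 < a" "a < 1" "0 < \<eta>"
    "\<And>n. \<exists>A\<subseteq>F. finite A \<and> card A = 2 ^ n \<and>
      (\<forall>x\<in>A. \<forall>y\<in>A. x \<noteq> y \<longrightarrow> \<eta> * a ^ n \<le> dist x y)"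
proof -
  obtain p q where pq: "p \<in> F" "q \<in> F" "p \<noteq> q"
    using assms nonempty_F by (metis is_singletonI')
  obtain D where D: "1 \<le> D" "\<And>x y. x \<in> F \<Longrightarrow> y \<in> F \<Longrightarrow> dist x y \<le> D"
    using diameter_bound by blast
  \<comment> \<open>Cylinders through \<open>p\<close> and \<open>q\<close> of diameter at most a
    third of \<open>dist p q\<close> leave a gap of at least another third between them.\<close>
  define \<eta> where "\<eta> = dist p q / 3"
  have \<eta>: "0 < \<eta>" using pq by (simp add: \<eta>_def)
  obtain m0 where m0: "c ^ m0 < \<eta> / D"
    using real_arch_pow_inv[of "\<eta> / D" c] c_less_1 \<eta> D by auto
  \<comment> \<open>The successor makes \<open>m\<close> positive, so that the ratio
    \<open>b ^ m\<close> is strictly below 1.\<close>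
  define m where "m = Suc m0"
  have "c ^ m \<le> c ^ m0" unfolding m_def using c_pos c_less_1 by (intro power_decreasing) auto
  then have "c ^ m \<le> \<eta> / D" using m0 by linarith
  then have m: "c ^ m * D \<le> \<eta>" using D by (simp add: field_simps)
  obtain T where T: "T ` F \<subseteq> F" "p \<in> T ` F"
    "\<And>u v. u \<in> F \<Longrightarrow> v \<in> F \<Longrightarrow> b ^ m * dist u v \<le> dist (T u) (T v)"
    "\<And>u v. u \<in> F \<Longrightarrow> v \<in> F \<Longrightarrow> dist (T u) (T v) \<le> c ^ m * dist u v"
    using cylinder_map[OF pq(1), of m] by blast
  obtain U where U: "U ` F \<subseteq> F" "q \<in> U ` F"
    "\<And>u v. u \<in> F \<Longrightarrow> v \<in> F \<Longrightarrow> b ^ m * dist u v \<le> dist (U u) (U v)"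
    "\<And>u v. u \<in> F \<Longrightarrow> v \<in> F \<Longrightarrow> dist (U u) (U v) \<le> c ^ m * dist u v"
    using cylinder_map[OF pq(2), of m] by blast
  have cD: "c ^ m * dist u v \<le> \<eta>" if "u \<in> F" "v \<in> F" for u v
    using m D(2)[OF that] c_pos by (meson mult_left_mono order_trans zero_le_power less_imp_le)
  have TU: "\<eta> \<le> dist (T u) (U v)" if uv: "u \<in> F" "v \<in> F" for u v
  proof -
    obtain p' q' where p': "p' \<in> F" "p = T p'" and q': "q' \<in> F" "q = U q'"
      using T(2) U(2) by blast
    have "dist p (T u) \<le> \<eta>" "dist (U v) q \<le> \<eta>"
      using T(4)[OF p'(1) uv(1)] U(4)[OF uv(2) q'(1)] cD[OF p'(1) uv(1)] cD[OF uv(2) q'(1)] p' q'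
      by auto
    moreover have "dist p q \<le> dist p (T u) + dist (T u) (U v) + dist (U v) q"
      by (meson add_right_mono dist_triangle order_trans)
    ultimately show ?thesis by (simp add: \<eta>_def)
  qed
  have bm: "0 < b ^ m" "b ^ m < 1"
    using b_pos b_le_c c_less_1 power_Suc_less_one[of b m0] by (auto simp: m_def)
  have "\<exists>A\<subseteq>F. finite A \<and> card A = 2 ^ n \<and>
      (\<forall>x\<in>A. \<forall>y\<in>A. x \<noteq> y \<longrightarrow> \<eta> * (b ^ m) ^ n \<le> dist x y)" for n
  proof (induction n)
    case 0
    show ?case using pq by (intro exI[of _ "{p}"]) auto
  next
    case (Suc n)
    then obtain A where A: "A \<subseteq> F" "finite A" "card A = 2 ^ n"
      "\<And>x y. x \<in> A \<Longrightarrow> y \<in> A \<Longrightarrow> x \<noteq> y \<Longrightarrow> \<eta> * (b ^ m) ^ n \<le> dist x y" by blast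
    have sepT: "\<eta> * (b ^ m) ^ Suc n \<le> dist (V x) (V y)"
      if V: "\<And>u v. u \<in> F \<Longrightarrow> v \<in> F \<Longrightarrow> b ^ m * dist u v \<le> dist (V u) (V v)"
        and xy: "x \<in> A" "y \<in> A" "x \<noteq> y" for V x y
    proof -
      have "\<eta> * (b ^ m) ^ Suc n = b ^ m * (\<eta> * (b ^ m) ^ n)" by (simp add: mult.left_commute)
      also have "\<dots> \<le> b ^ m * dist x y"
        using A(4)[OF xy] bm by (intro mult_left_mono) auto
      also have "\<dots> \<le> dist (V x) (V y)" using V xy A(1) by blast
      finally show ?thesis .
    qed
    have pos: "0 < \<eta> * (b ^ m) ^ Suc n" using \<eta> bm by simp
    have inj: "inj_on V A"
      if V: "\<And>u v. u \<in> F \<Longrightarrow> v \<in> F \<Longrightarrow> b ^ m * dist u v \<le> dist (V u) (V v)" for V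
      using sepT[OF V] pos by (intro inj_onI) (metis dist_self not_less)
    \<comment> \<open>Points from different cylinders are already \<open>\<eta>\<close> apart, which
      is more than the separation required at the next step.\<close>
    have small: "\<eta> * (b ^ m) ^ Suc n \<le> \<eta>"
      by (rule mult_left_le[OF power_le_one]) (use \<eta> bm in auto)
    have cross: "\<eta> * (b ^ m) ^ Suc n \<le> dist (T x) (U y)" if "x \<in> A" "y \<in> A" for x y
      using TU[of x y] that A(1) small by force
    have disj: "T ` A \<inter> U ` A = {}" using cross pos by (fastforce simp: not_less[symmetric])
    show ?case
    proof (intro exI[of _ "T ` A \<union> U ` A"] conjI ballI impI)
      show "T ` A \<union> U ` A \<subseteq> F" using T(1) U(1) A(1) by blast
      show "finite (T ` A \<union> U ` A)" using A by simp
      show "card (T ` A \<union> U ` A) = 2 ^ Suc n"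
        using A disj inj[OF T(3)] inj[OF U(3)] by (simp add: card_Un_disjoint card_image)
      fix x y assume "x \<in> T ` A \<union> U ` A" "y \<in> T ` A \<union> U ` A" "x \<noteq> y"
      then show "\<eta> * (b ^ m) ^ Suc n \<le> dist x y"
        using sepT[OF T(3)] sepT[OF U(3)] cross by (elim UnE imageE) (metis dist_commute)+
    qed
  qed
  then show thesis using that[OF bm \<eta>] by blast
qed

text \<open>\<open>F\<close> contains \<open>2 ^ n\<close> points at mutual distance at least
  \<open>\<eta> * a ^ n\<close>, so covering numbers grow at least like a positive power of
  \<open>1 / r\<close>.\<close>

lemma lower_box_dim_pos:
  assumes "\<not> is_singleton F"
  shows "0 < lower_box_dim F"
proof -
  obtain a \<eta> where a: "0 < a" "a < 1" "0 < \<eta>"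
    and sep: "\<And>n. \<exists>A\<subseteq>F. finite A \<and> card A = 2 ^ n \<and>
      (\<forall>x\<in>A. \<forall>y\<in>A. x \<noteq> y \<longrightarrow> \<eta> * a ^ n \<le> dist x y)"
    using separated_points[OF assms] by metis
  \<comment> \<open>The solution of \<open>a powr t = 1 / 2\<close>, which turns
    \<open>(a ^ n) powr (-t)\<close> into \<open>2 ^ n\<close>.\<close>
  define t where "t = ln 2 / - ln a"
  have t: "0 < t" using a by (auto simp: t_def intro!: divide_pos_neg)
  have a_t: "a powr t = 1 / 2"
    using a by (simp add: powr_def t_def exp_minus inverse_eq_divide)
  \<comment> \<open>One factor \<open>a\<close> pays for rounding the scale to a power of
    \<open>a\<close>. The other makes \<open>r < \<eta> * a ^ n\<close> strict, as the separation
    lemma requires.\<close>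
  define C where "C = (\<eta> * a * a) powr t"
  have "C * r powr (-t) \<le> real (covering_number r F)"
    if r: "0 < r" "r < \<eta> * a * a" for r
  proof -
    have q: "0 < r / (\<eta> * a * a)" "r / (\<eta> * a * a) \<le> 1" using r a by auto
    obtain n where n: "a ^ n \<le> r / (\<eta> * a * a)" "a * (r / (\<eta> * a * a)) \<le> a ^ n"
      by (rule geometric_bracket[OF a(1,2) q])
    have "r < r / a" using r a by (simp add: field_simps)
    also have "\<dots> \<le> \<eta> * a ^ n" using n(2) a by (simp add: field_simps)
    finally have rn: "r < \<eta> * a ^ n" .
    obtain A where A: "A \<subseteq> F" "card A = 2 ^ n"
      "\<And>x y. x \<in> A \<Longrightarrow> y \<in> A \<Longrightarrow> x \<noteq> y \<Longrightarrow> \<eta> * a ^ n \<le> dist x y" using sep[of n] by blast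
    have "card A \<le> covering_number r F"
      using A rn r by (intro card_separated_le_covering_number[OF compact_F]) force+
    then have N: "2 ^ n \<le> real (covering_number r F)" using A(2)
      by (metis of_nat_le_iff of_nat_numeral of_nat_power)
    have "C * r powr (-t) = (r / (\<eta> * a * a)) powr (-t)"
      using r a by (simp add: C_def powr_divide powr_minus field_simps)
    also have "\<dots> \<le> (a ^ n) powr (-t)"
      using n(1) a t by (intro powr_mono2') auto
    also have "\<dots> = (a powr t) powr (- real n)"
      using a by (simp add: powr_powr powr_realpow[symmetric] mult.commute)
    also have "\<dots> = 2 ^ n"
      unfolding a_t by (simp add: powr_minus powr_realpow power_one_over)
    finally show ?thesis using N by linarith
  qed
  moreover have "0 < C" "0 < \<eta> * a * a" using a by (auto simp: C_def)
  ultimately have "ereal t \<le> lower_box_dim F"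
    by (intro lower_box_dim_geI)
  then show ?thesis using t by (metis ereal_less(2) less_le_trans)
qed

section \<open>The lower spectrum compared with the lower box dimension\<close>

text \<open>For \<open>\<rho> = r powr \<theta>\<close> the pulled-back scale is at most
  \<open>K * r powr ?g\<close>. For \<open>\<alpha>\<close> below the box dimension, the local
  covering number is therefore at least a constant times \<open>r powr (- (?g * \<alpha>))\<close>,
  which is \<open>(r powr \<theta> / r) powr (?f * \<alpha>)\<close>.\<close>

lemma lower_spectrum_ge:
  assumes "0 < \<theta>" "\<theta> < 1" "\<theta> * distortion < 1" "0 < lower_box_dim F"
  shows "ereal ((1 - \<theta> * distortion) / (1 - \<theta>)) * lower_box_dim F \<le> lower_spectrum \<theta> F"
proof -
  let ?g = "1 - \<theta> * distortion"
  let ?f = "?g / (1 - \<theta>)"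
  have g: "0 < ?g" and f: "0 < ?f" using assms by auto
  obtain K where K: "0 < K"
    "\<And>x r \<rho>. x \<in> F \<Longrightarrow> 0 < r \<Longrightarrow> 0 < \<rho> \<Longrightarrow> \<rho> \<le> 1 \<Longrightarrow>
      \<exists>R. 0 < R \<and> R \<le> K * r * \<rho> powr (- distortion) \<and>
        covering_number R F \<le> covering_number r (cball x \<rho> \<inter> F)"
    using covering_number_cball_ge by metis
  have real_case: "ereal (?f * \<alpha>) \<le> lower_spectrum \<theta> F"
    if \<alpha>: "0 \<le> \<alpha>" "ereal \<alpha> < lower_box_dim F" for \<alpha>
  proof -
    obtain R0 where R0: "0 < R0"
      "\<And>R. 0 < R \<Longrightarrow> R < R0 \<Longrightarrow> R powr (-\<alpha>) \<le> real (covering_number R F)"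
      using covering_number_ge_of_less_lower_box_dim[OF compact_F nonempty_F \<alpha>(2)] by metis
    \<comment> \<open>The solution of \<open>K * r0 powr ?g = R0\<close>: for \<open>r < r0\<close>
      the pulled-back scale lies in the range where the bound for \<open>F\<close> holds.\<close>
    define r0 where "r0 = (R0 / K) powr (1 / ?g)"
    have r0: "0 < r0" using R0 K by (simp add: r0_def)
    have r0g: "K * r0 powr ?g = R0" using g R0 K by (simp add: r0_def powr_powr)
    \<comment> \<open>The first entry serves \<open>r < r0\<close>. The second serves
      \<open>r0 \<le> r\<close>, where the covering number is only known to be at least 1.\<close>
    define C where "C = min (K powr (-\<alpha>)) (r0 powr (?g * \<alpha>))"
    have C: "0 < C" using K r0 by (simp add: C_def)
    have "C * (r powr \<theta> / r) powr (?f * \<alpha>) \<le> real (covering_number r (cball x (r powr \<theta>) \<inter> F))"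
      if r: "0 < r" "r < 1" and x: "x \<in> F" for r x
    proof -
      have "(\<theta> - 1) * (?f * \<alpha>) = - (?g * \<alpha>)" using assms by (simp add: field_simps)
      moreover have "r powr \<theta> / r = r powr (\<theta> - 1)" using r by (simp add: powr_diff)
      ultimately have lhs: "(r powr \<theta> / r) powr (?f * \<alpha>) = r powr (- (?g * \<alpha>))"
        by (simp only: powr_powr)
      show ?thesis
      proof (cases "r < r0")
        case True
        obtain R where R: "0 < R" "R \<le> K * r * (r powr \<theta>) powr (- distortion)"
          "covering_number R F \<le> covering_number r (cball x (r powr \<theta>) \<inter> F)"
          using K(2)[OF x r(1), of "r powr \<theta>"] r assms by (auto simp: powr_le1)
        have "r * (r powr \<theta>) powr (- distortion) = r powr ?g"
          using r by (simp add: powr_powr powr_diff powr_minus field_simps)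
        then have RK: "R \<le> K * r powr ?g" using R(2) by (simp add: mult.assoc)
        also have "\<dots> < R0"
          unfolding r0g[symmetric] using True r g K by (intro mult_strict_left_mono powr_less_mono2) auto
        finally have "R powr (-\<alpha>) \<le> real (covering_number R F)" using R0(2) R(1) by blast
        moreover have "(K * r powr ?g) powr (-\<alpha>) \<le> R powr (-\<alpha>)"
          using RK R(1) \<alpha>(1) by (intro powr_mono2') auto
        moreover have "(K * r powr ?g) powr (-\<alpha>) = K powr (-\<alpha>) * r powr (- (?g * \<alpha>))"
          using K r by (simp add: powr_mult powr_powr)
        moreover have "C * r powr (- (?g * \<alpha>)) \<le> K powr (-\<alpha>) * r powr (- (?g * \<alpha>))"
          by (intro mult_right_mono) (auto simp: C_def)
        ultimately show ?thesis unfolding lhs using R(3) by linarith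
      next
        case False
        have "C * r powr (- (?g * \<alpha>)) \<le> r0 powr (?g * \<alpha>) * r0 powr (- (?g * \<alpha>))"
          using False r0 \<alpha>(1) g C by (intro mult_mono powr_mono2') (auto simp: C_def)
        also have "\<dots> = 1" using r0 by (simp add: powr_minus)
        also have "1 \<le> real (covering_number r (cball x (r powr \<theta>) \<inter> F))"
          using covering_number_pos[OF compact_F, of "cball x (r powr \<theta>) \<inter> F" r] x r by force
        finally show ?thesis unfolding lhs .
      qed
    qed
    then have "\<exists>C>0. \<forall>r. 0 < r \<and> r < 1 \<longrightarrow> (\<forall>x\<in>F.
        C * (r powr \<theta> / r) powr (?f * \<alpha>) \<le> real (covering_number r (cball x (r powr \<theta>) \<inter> F)))"
      using C by (intro exI[of _ C]) simp
    moreover have "0 \<le> ?f * \<alpha>" using mult_nonneg_nonneg[OF less_imp_le[OF f] \<alpha>(1)] .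
    ultimately show ?thesis
      unfolding lower_spectrum_def by (intro Sup_upper) blast
  qed
  have nonneg: "0 \<le> lower_spectrum \<theta> F"
    using real_case[of 0] assms(4) by (simp add: zero_ereal_def)
  have "lower_box_dim F \<le> lower_spectrum \<theta> F / ereal ?f"
  \<comment> \<open>Approximating from below treats finite and infinite dimension alike: a
    nonnegative \<open>z\<close> below the dimension is real, and a negative one is covered by
    \<open>nonneg\<close>.\<close>
  proof (rule dense_le)
    fix z assume z: "z < lower_box_dim F"
    show "z \<le> lower_spectrum \<theta> F / ereal ?f"
    proof (cases "0 \<le> z")
      case True
      then obtain \<alpha> where \<alpha>: "z = ereal \<alpha>" "0 \<le> \<alpha>" using z by (cases z) auto
      then show ?thesis using real_case[of \<alpha>] z f by (simp add: ereal_le_divide_pos)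
    next
      case False
      moreover have "0 \<le> lower_spectrum \<theta> F / ereal ?f"
        using nonneg f by (simp add: ereal_le_divide_pos)
      ultimately show ?thesis by (meson linear order_trans)
    qed
  qed
  then show ?thesis using f by (simp add: ereal_le_divide_pos)
qed

text \<open>Covering all of \<open>F\<close> costs at least as much as covering its part in one
  ball, and \<open>(r powr \<theta> / r) powr \<alpha>\<close> equals
  \<open>r powr (- ((1 - \<theta>) * \<alpha>))\<close>.\<close>

lemma lower_spectrum_le:
  assumes "0 < \<theta>" "\<theta> < 1"
  shows "lower_spectrum \<theta> F \<le> lower_box_dim F / ereal (1 - \<theta>)"
  unfolding lower_spectrum_def
proof (rule Sup_least, clarify)
  fix \<alpha> C :: real
  assume \<alpha>: "0 \<le> \<alpha>" and C: "0 < C"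
    and low: "\<forall>r. 0 < r \<and> r < 1 \<longrightarrow>
      (\<forall>x\<in>F. C * (r powr \<theta> / r) powr \<alpha> \<le> real (covering_number r (cball x (r powr \<theta>) \<inter> F)))"
  obtain x where x: "x \<in> F" using nonempty_F by blast
  have "ereal ((1 - \<theta>) * \<alpha>) \<le> lower_box_dim F"
  proof (rule lower_box_dim_geI[of C 1])
    fix r :: real assume r: "0 < r" "r < 1"
    have "r powr \<theta> / r = r powr (\<theta> - 1)" using r by (simp add: powr_diff)
    then have "(r powr \<theta> / r) powr \<alpha> = r powr (- ((1 - \<theta>) * \<alpha>))"
      by (simp add: powr_powr algebra_simps)
    then have "C * r powr (- ((1 - \<theta>) * \<alpha>)) \<le> real (covering_number r (cball x (r powr \<theta>) \<inter> F))"
      using low r x by metis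
    also have "\<dots> \<le> real (covering_number r F)"
      using covering_number_mono[OF compact_F, of _ F r] r by simp
    finally show "C * r powr (- ((1 - \<theta>) * \<alpha>)) \<le> real (covering_number r F)" .
  qed (use C in auto)
  then show "ereal \<alpha> \<le> lower_box_dim F / ereal (1 - \<theta>)"
    using assms by (simp add: ereal_le_divide_pos)
qed

lemma lower_spectrum_tendsto:
  assumes "\<not> is_singleton F"
  shows "((\<lambda>\<theta>. lower_spectrum \<theta> F) \<longlongrightarrow> lower_box_dim F) (at_right 0)"
proof (rule tendsto_sandwich)
  let ?B = "lower_box_dim F" and ?s = distortion
  have B: "0 < ?B" using lower_box_dim_pos[OF assms] .
  have ev: "eventually (\<lambda>\<theta>. 0 < \<theta> \<and> \<theta> < 1 \<and> \<theta> * ?s < 1) (at_right 0)"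
    unfolding eventually_at_right_field using distortion_pos
    by (intro exI[of _ "min 1 (1 / ?s)"]) (auto simp: field_simps)
  show "eventually (\<lambda>\<theta>. ereal ((1 - \<theta> * ?s) / (1 - \<theta>)) * ?B \<le> lower_spectrum \<theta> F) (at_right 0)"
    using ev by eventually_elim (use lower_spectrum_ge B in auto)
  show "eventually (\<lambda>\<theta>. lower_spectrum \<theta> F \<le> ereal (1 / (1 - \<theta>)) * ?B) (at_right 0)"
    using ev
  proof eventually_elim
    case (elim \<theta>)
    then show ?case using lower_spectrum_le[of \<theta>]
      by (simp add: divide_ereal_def mult.commute inverse_eq_divide)
  qed
  \<comment> \<open>The real factor tends to 1, not to 0, so the extended product converges even if
    \<open>?B\<close> is infinite.\<close>
  have lim: "((\<lambda>\<theta>. ereal (h \<theta>) * ?B) \<longlongrightarrow> ?B) (at_right 0)"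
    if "(h \<longlongrightarrow> 1) (at_right 0)" for h :: "real \<Rightarrow> real"
    using tendsto_mult_ereal[OF tendsto_ereal[OF that] tendsto_const[of ?B]] by (simp add: one_ereal_def[symmetric])
  have "((\<lambda>\<theta>::real. (1 - \<theta> * ?s) / (1 - \<theta>)) \<longlongrightarrow> (1 - 0 * ?s) / (1 - 0)) (at_right 0)"
    by (intro tendsto_intros) auto
  then show "((\<lambda>\<theta>. ereal ((1 - \<theta> * ?s) / (1 - \<theta>)) * ?B) \<longlongrightarrow> ?B) (at_right 0)"
    by (intro lim) simp
  have "((\<lambda>\<theta>::real. 1 / (1 - \<theta>)) \<longlongrightarrow> 1 / (1 - 0)) (at_right 0)"
    by (intro tendsto_intros) auto
  then show "((\<lambda>\<theta>. ereal (1 / (1 - \<theta>)) * ?B) \<longlongrightarrow> ?B) (at_right 0)"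
    by (intro lim) simp
qed

lemma lower_spectrum_pos:
  assumes "\<not> is_singleton F" "0 < \<theta>" "\<theta> < 1" "\<theta> * distortion < 1"
  shows "0 < lower_spectrum \<theta> F"
proof -
  have B: "0 < lower_box_dim F" using lower_box_dim_pos[OF assms(1)] .
  have "0 < ereal ((1 - \<theta> * distortion) / (1 - \<theta>)) * lower_box_dim F"
    using B assms by (simp add: ereal_zero_less_0_iff)
  also have "\<dots> \<le> lower_spectrum \<theta> F" using lower_spectrum_ge B assms by blast
  finally show ?thesis .
qed

end

section \<open>Application to iterated function systems\<close>

text \<open>Finiteness of \<open>I\<close> allows the minimum of the lower and the maximum of the
  upper constants; the maximum stays below 1.\<close>

lemma uniform_bilipschitz_constants:
  assumes "finite I" "\<forall>i\<in>I. bilipschitz_contraction_on X (S i)"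
  obtains b c where "0 < b" "b \<le> c" "c < (1::real)"
    "\<And>i x y. i \<in> I \<Longrightarrow> x \<in> X \<Longrightarrow> y \<in> X \<Longrightarrow>
      b * dist x y \<le> dist (S i x) (S i y) \<and> dist (S i x) (S i y) \<le> c * dist x y"
proof -
  have "\<exists>b c. 0 < b \<and> b \<le> c \<and> c < (1::real) \<and> (\<forall>i\<in>I. \<forall>x\<in>X. \<forall>y\<in>X.
      b * dist x y \<le> dist (S i x) (S i y) \<and> dist (S i x) (S i y) \<le> c * dist x y)"
    using assms
  proof (induction rule: finite_induct)
    case empty
    show ?case by (intro exI[of _ "1 / 2"]) auto
  next
    case (insert j J)
    obtain b c where bc: "0 < b" "b \<le> c" "c < 1" "\<forall>i\<in>J. \<forall>x\<in>X. \<forall>y\<in>X.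
      b * dist x y \<le> dist (S i x) (S i y) \<and> dist (S i x) (S i y) \<le> c * dist x y"
      using insert by auto
    obtain b' c' where bc': "0 < b'" "b' \<le> c'" "c' < 1" "\<forall>x\<in>X. \<forall>y\<in>X.
      b' * dist x y \<le> dist (S j x) (S j y) \<and> dist (S j x) (S j y) \<le> c' * dist x y"
      using insert.prems unfolding bilipschitz_contraction_on_def by auto
    have le: "min b b' * d \<le> b * d" "min b b' * d \<le> b' * d" "c * d \<le> max c c' * d"
      "c' * d \<le> max c c' * d" if "0 \<le> d" for d :: real
      using that by (auto intro: mult_right_mono)
    show ?case
    proof (rule exI[of _ "min b b'"], rule exI[of _ "max c c'"], intro conjI ballI)
      fix i x y assume i: "i \<in> insert j J" and xy: "x \<in> X" "y \<in> X"
      show "min b b' * dist x y \<le> dist (S i x) (S i y)"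
        using i xy bc(4) bc'(4) le(1,2)[OF zero_le_dist, of x y] by (blast intro: order_trans)
      show "dist (S i x) (S i y) \<le> max c c' * dist x y"
        using i xy bc(4) bc'(4) le(3,4)[OF zero_le_dist, of x y] by (blast intro: order_trans)
    qed (use bc bc' in auto)
  qed
  then show thesis using that by blast
qed

theorem theorem6p3p1:
  fixes X F :: "(real ^ 'd) set"
    and I :: "'i set"
    and S :: "'i \<Rightarrow> real ^ 'd \<Rightarrow> real ^ 'd"
  assumes "iterated_function_system X I S"
    and "\<forall>i\<in>I. bilipschitz_contraction_on X (S i)"
    and "is_attractor X I S F"
    and "\<not> is_singleton F"
  shows "(\<exists>\<theta>\<^sub>0. 0 < \<theta>\<^sub>0 \<and> \<theta>\<^sub>0 < 1 \<and>
            (\<forall>\<theta>. 0 < \<theta> \<and> \<theta> < \<theta>\<^sub>0 \<longrightarrow> lower_spectrum \<theta> F > 0)) \<and>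
         ((\<lambda>\<theta>. lower_spectrum \<theta> F) \<longlongrightarrow> lower_box_dim F) (at_right 0)"
proof -
  have "finite I" using assms(1) by (simp add: iterated_function_system_def)
  then obtain b c where bc: "0 < b" "b \<le> c" "c < 1"
    "\<And>i x y. i \<in> I \<Longrightarrow> x \<in> X \<Longrightarrow> y \<in> X \<Longrightarrow>
      b * dist x y \<le> dist (S i x) (S i y) \<and> dist (S i x) (S i y) \<le> c * dist x y"
    using uniform_bilipschitz_constants[OF _ assms(2)] by metis
  have F: "F \<noteq> {}" "compact F" "F \<subseteq> X" "F = (\<Union>i\<in>I. S i ` F)"
    using assms(3) unfolding is_attractor_def by blast+
  interpret bilipschitz_self_covering F I S b c
    using F bc by unfold_locales blast+
  \<comment> \<open>The bound \<open>1 / distortion\<close> ensures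
    \<open>\<theta> * distortion < 1\<close>; the bound \<open>1 / 2\<close> keeps the threshold
    strictly below 1.\<close>
  let ?\<theta> = "min (1 / 2) (1 / distortion)"
  have "0 < lower_spectrum \<theta> F" if "0 < \<theta>" "\<theta> < ?\<theta>" for \<theta>
    using that distortion_pos assms(4)
    by (intro lower_spectrum_pos) (auto simp: field_simps)
  moreover have "0 < ?\<theta>" "?\<theta> < 1" using distortion_pos by auto
  ultimately show ?thesis using lower_spectrum_tendsto[OF assms(4)] by blast
qed

end
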